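(* Let $(X,\mathcal{A})$ and $(Y,\mathcal{B})$ be separated realcompact measurable spaces. Then $(X,\mathcal{A})$ and $(Y,\mathcal{B})$ are isomorphic as measurable spaces if and only if the rings $\mathcal{M}(X,\mathcal{A})$ and $\mathcal{M}(Y,\mathcal{B})$ are isomorphic.
   Context: A measurable space $(X,\mathcal{A})$ is a nonempty set $X$ with a $\sigma$-algebra $\mathcal{A}$ of subsets of $X$. $\mathcal{M}(X,\mathcal{A})$ is the commutative ring with unity (pointwise operations) of all $\mathcal{A}$-measurable functions $f:X\to\mathbb{R}$. For $f\in\mathcal{M}(X,\mathcal{A})$, $Z(f)=\{x\in X: f(x)=0\}$. Ideals are assumed proper. $(X,\mathcal{A})$ is separated if for any two distinct points $p,q\in X$ there is $E\in\mathcal{A}$ containing exactly one of them. A maximal ideal $M$ of $\mathcal{M}(X,\mathcal{A})$ is real if the canonical map $\mathcal{M}(X,\mathcal{A})\to\mathcal{M}(X,\mathcal{A})/M$ sends the set of constant functions onto all of $\mathcal{M}(X,\mathcal{A})/M$. An ideal $I$ is fixed if $\bigcap_{f\in I}Z(f)\neq\emptyset$. $(X,\mathcal{A})$ is realcompact if every real maximal ideal of $\mathcal{M}(X,\mathcal{A})$ is fixed. An isomorphism between measurable spaces $(X,\mathcal{A})$ and $(Y,\mathcal{B})$ is a bijection $t:X\to Y$ such that for every $E\subseteq X$, $E\in\mathcal{A}$ if and only if $t(E)\in\mathcal{B}$. *)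

theory Defs
  imports "HOL-Analysis.Analysis" "HOL-Algebra.QuotRing"
begin

text \<open>
  A measurable space is given by \<^term>\<open>space M\<close> and \<^term>\<open>sets M\<close> of some
  \<^typ>\<open>'a measure\<close>; the measure itself is irrelevant and never used. Nonemptiness of the
  underlying set has to be assumed separately.
\<close>

definition separated_space :: "'a measure \<Rightarrow> bool" where
  "separated_space M \<longleftrightarrow>
     (\<forall>p\<in>space M. \<forall>q\<in>space M. p \<noteq> q \<longrightarrow> (\<exists>E\<in>sets M. (p \<in> E) \<noteq> (q \<in> E)))"

text \<open>
  Functions on \<^term>\<open>space M\<close> are represented by total functions that are \<^term>\<open>undefined\<close>
  outside \<^term>\<open>space M\<close>, so that equality in the ring is equality on \<^term>\<open>space M\<close>.
\<close>

definition measurable_ring :: "'a measure \<Rightarrow> ('a \<Rightarrow> real) ring" where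
  "measurable_ring M =
     \<lparr>carrier = borel_measurable M \<inter> extensional (space M),
      monoid.mult = (\<lambda>f g. \<lambda>x\<in>space M. f x * g x),
      one = (\<lambda>x\<in>space M. 1),
      zero = (\<lambda>x\<in>space M. 0),
      add = (\<lambda>f g. \<lambda>x\<in>space M. f x + g x)\<rparr>"

lemma cring_measurable_ring: "cring (measurable_ring M)"
proof -
  have "\<exists>g\<in>carrier (measurable_ring M). g \<oplus>\<^bsub>measurable_ring M\<^esub> f = \<zero>\<^bsub>measurable_ring M\<^esub>"
    if "f \<in> carrier (measurable_ring M)" for f
    using that
    by (intro bexI[of _ "\<lambda>x\<in>space M. - f x"])
       (auto simp: measurable_ring_def restrict_def extensional_def intro!: ext borel_measurable_uminus
             cong: measurable_cong)
  then show ?thesis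
    by (intro cringI abelian_groupI comm_monoidI)
       (auto simp: measurable_ring_def fun_eq_iff restrict_def extensional_def algebra_simps
             intro!: borel_measurable_times borel_measurable_add cong: measurable_cong)
qed

definition constant_functions :: "'a measure \<Rightarrow> ('a \<Rightarrow> real) set" where
  "constant_functions M = range (\<lambda>c. \<lambda>x\<in>space M. c)"

definition zero_set :: "'a measure \<Rightarrow> ('a \<Rightarrow> real) \<Rightarrow> 'a set" where
  "zero_set M f = {x \<in> space M. f x = 0}"

definition real_maximal_ideal :: "'a measure \<Rightarrow> ('a \<Rightarrow> real) set \<Rightarrow> bool" where
  "real_maximal_ideal M I \<longleftrightarrow>
     maximalideal I (measurable_ring M) \<and>
     (\<lambda>f. I +>\<^bsub>measurable_ring M\<^esub> f) ` constant_functions M = carrier (measurable_ring M Quot I)"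

text \<open>
  Ideals are assumed proper; this need not be demanded here, as the function 1 has an empty zero set.
\<close>

definition fixed_ideal :: "'a measure \<Rightarrow> ('a \<Rightarrow> real) set \<Rightarrow> bool" where
  "fixed_ideal M I \<longleftrightarrow> ideal I (measurable_ring M) \<and> (\<Inter>f\<in>I. zero_set M f) \<noteq> {}"

definition realcompact_space :: "'a measure \<Rightarrow> bool" where
  "realcompact_space M \<longleftrightarrow> (\<forall>I. real_maximal_ideal M I \<longrightarrow> fixed_ideal M I)"

definition measurable_space_iso :: "'a measure \<Rightarrow> 'b measure \<Rightarrow> ('a \<Rightarrow> 'b) \<Rightarrow> bool" where
  "measurable_space_iso M N t \<longleftrightarrow>
     bij_betw t (space M) (space N) \<and>
     (\<forall>E. E \<subseteq> space M \<longrightarrow> (E \<in> sets M \<longleftrightarrow> t ` E \<in> sets N))"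

definition isomorphic_measurable_spaces :: "'a measure \<Rightarrow> 'b measure \<Rightarrow> bool" where
  "isomorphic_measurable_spaces M N \<longleftrightarrow> (\<exists>t. measurable_space_iso M N t)"

end

theory Submission
  imports Defs
begin

text \<open>
  Given a ring isomorphism \<open>\<phi>\<close> and a point \<open>y\<close>, the map \<open>f \<mapsto> \<phi> f y\<close> is a ring homomorphism to the
  reals. It fixes the constants because the identity is the only ring endomorphism of the reals,
  so its kernel is a real maximal ideal; by realcompactness this ideal is fixed, and hence the map
  is evaluation at some point \<open>s y\<close>. The same construction for the inverse of \<open>\<phi>\<close> gives a map \<open>t\<close>
  with \<open>f (s (t x)) = f x\<close> for all measurable \<open>f\<close>, and separatedness makes \<open>s\<close> and \<open>t\<close> mutually
  inverse. Measurability of images is read off from \<open>\<phi>\<close> on indicator functions.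
\<close>

section \<open>Ring endomorphisms of the reals\<close>

text \<open>Order is algebraic here: nonnegative reals are squares, so \<open>r\<close> is monotone.
  It fixes every rational, and a rational strictly between \<open>r x\<close> and \<open>x\<close>
  would contradict monotonicity.\<close>

lemma real_ring_endomorphism_eq_id:
  fixes r :: "real \<Rightarrow> real"
  assumes add: "\<And>x y. r (x + y) = r x + r y"
    and mult: "\<And>x y. r (x * y) = r x * r y"
    and one: "r 1 = 1"
  shows "r x = x"
proof -
  interpret additive r
    by standard (rule add)
  have nat: "r (real n) = real n" for n
    by (induction n) (simp_all add: zero add one)
  have int: "r (real_of_int k) = real_of_int k" for k
    by (cases k rule: int_cases2) (simp_all add: nat minus)
  have rat: "r q = q" if "q \<in> \<rat>" for q
  proof -
    from that obtain a b where b: "b > 0" and q: "q = real_of_int a / real_of_int b"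
      by (auto elim: Rats_cases')
    have "r q * real_of_int b = r (q * real_of_int b)"
      by (simp only: mult int)
    also have "\<dots> = real_of_int a"
      using b by (simp add: q int)
    finally show ?thesis
      using b by (simp add: q field_simps)
  qed
  have nonneg: "0 \<le> r z" if "0 \<le> z" for z
  proof -
    have "r z = r (sqrt z) * r (sqrt z)"
      using that by (simp flip: mult)
    then show ?thesis
      by simp
  qed
  have mono: "r u \<le> r v" if "u \<le> v" for u v
    using nonneg[of "v - u"] that by (simp add: diff)
  show ?thesis
  proof (rule linorder_cases[of "r x" x])
    assume "r x < x"
    then obtain q where "q \<in> \<rat>" "r x < q" "q < x"
      using Rats_dense_in_real by blast
    with mono[of q x] rat show ?thesis by simp
  next
    assume "x < r x"
    then obtain q where "q \<in> \<rat>" "x < q" "q < r x"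
      using Rats_dense_in_real by blast
    with mono[of x q] rat show ?thesis by simp
  qed simp
qed

section \<open>Characters of the ring of measurable functions\<close>

lemma measurable_ring_simps:
  "f \<in> carrier (measurable_ring M) \<longleftrightarrow> f \<in> borel_measurable M \<and> f \<in> extensional (space M)"
  "f \<otimes>\<^bsub>measurable_ring M\<^esub> g = (\<lambda>x\<in>space M. f x * g x)"
  "\<one>\<^bsub>measurable_ring M\<^esub> = (\<lambda>x\<in>space M. 1)"
  "\<zero>\<^bsub>measurable_ring M\<^esub> = (\<lambda>x\<in>space M. 0)"
  "f \<oplus>\<^bsub>measurable_ring M\<^esub> g = (\<lambda>x\<in>space M. f x + g x)"
  by (simp_all add: measurable_ring_def)

lemma restrict_in_carrier_measurable_ring:
  assumes "f \<in> borel_measurable M"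
  shows "(\<lambda>x\<in>space M. f x) \<in> carrier (measurable_ring M)"
  using assms by (simp add: measurable_ring_simps cong: measurable_cong)

lemma constant_in_carrier_measurable_ring [simp]:
  "(\<lambda>x\<in>space M. c) \<in> carrier (measurable_ring M)"
  by (rule restrict_in_carrier_measurable_ring) simp

text \<open>The key is to subtract from \<open>f\<close> the constant with value \<open>h f\<close>:
  the difference lies in the kernel of \<open>h\<close>. This shows that constants represent all
  cosets of the kernel, and a common zero of the kernel is then the point of evaluation.\<close>

lemma realcompact_character_eq_evaluation:
  fixes M :: "'a measure" and h :: "('a \<Rightarrow> real) \<Rightarrow> real"
  defines "R \<equiv> measurable_ring M"
  assumes realcompact: "realcompact_space M"
    and h_add: "\<And>f g. f \<in> carrier R \<Longrightarrow> g \<in> carrier R \<Longrightarrow> h (f \<oplus>\<^bsub>R\<^esub> g) = h f + h g"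
    and h_mult: "\<And>f g. f \<in> carrier R \<Longrightarrow> g \<in> carrier R \<Longrightarrow> h (f \<otimes>\<^bsub>R\<^esub> g) = h f * h g"
    and h_one: "h \<one>\<^bsub>R\<^esub> = 1"
  shows "\<exists>x\<in>space M. \<forall>f\<in>carrier R. h f = f x"
proof -
  interpret cring R
    unfolding R_def by (rule cring_measurable_ring)
  define C where "C c = (\<lambda>x\<in>space M. c)" for c :: real
  have C_carrier [simp]: "C c \<in> carrier R" for c
    by (simp add: C_def R_def)
  have C_zero: "C 0 = \<zero>\<^bsub>R\<^esub>" and C_one: "C 1 = \<one>\<^bsub>R\<^esub>"
    and C_add: "C (a + b) = C a \<oplus>\<^bsub>R\<^esub> C b" and C_mult: "C (a * b) = C a \<otimes>\<^bsub>R\<^esub> C b" for a b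
    by (auto simp: C_def R_def measurable_ring_simps)
  \<comment> \<open>Composed with \<open>C\<close>, the character becomes a unital ring endomorphism
    of the reals.\<close>
  have h_C: "h (C c) = c" for c
    by (rule real_ring_endomorphism_eq_id[of "\<lambda>c. h (C c)"])
       (simp_all add: C_add C_mult C_one h_add h_mult h_one)
  have h_zero: "h \<zero>\<^bsub>R\<^esub> = 0"
    using h_C[of 0] by (simp add: C_zero)
  have h_minus: "h (\<ominus>\<^bsub>R\<^esub> f) = - h f" if "f \<in> carrier R" for f
    using h_add[of f "\<ominus>\<^bsub>R\<^esub> f"] that by (simp add: r_neg h_zero)
  have h_diff: "h (f \<ominus>\<^bsub>R\<^esub> g) = h f - h g" if "f \<in> carrier R" "g \<in> carrier R" for f g
    using that by (simp add: minus_eq h_add h_minus)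
  define I where "I = {f \<in> carrier R. h f = 0}"
  have ideal: "ideal I R"
  proof (rule idealI)
    show "subgroup I (add_monoid R)"
      by (rule add.subgroupI)
         (auto simp: I_def h_add h_zero h_minus simp flip: a_inv_def)
  qed (auto simp: I_def h_mult intro: ring_axioms)
  have shift: "f \<ominus>\<^bsub>R\<^esub> C (h f) \<in> I" if "f \<in> carrier R" for f
    using that by (simp add: I_def h_diff h_C)
  have maximal: "maximalideal I R"
  proof (rule maximalidealI[OF ideal])
    show "carrier R \<noteq> I"
      using h_one one_closed by (force simp: I_def)
  next
    fix J assume J: "ideal J R" "I \<subseteq> J" "J \<subseteq> carrier R"
    interpret J: ideal J R by fact
    show "J = I \<or> J = carrier R"
    proof (cases "J = I")
      case False
      then obtain f where f: "f \<in> J" "f \<notin> I"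
        using J by blast
      then have fR: "f \<in> carrier R" and nz: "h f \<noteq> 0"
        using J by (auto simp: I_def)
      \<comment> \<open>Scaling normalises \<open>f\<close> to an element of \<open>J\<close> with
        character value 1. It differs from the unit by an element of the kernel \<open>I\<close>,
        which lies in \<open>J\<close>, so \<open>J\<close> contains the unit.\<close>
      let ?g = "C (inverse (h f)) \<otimes>\<^bsub>R\<^esub> f"
      have g: "?g \<in> J" and gR: "?g \<in> carrier R" and hg: "h ?g = 1"
        using f fR nz by (simp_all add: J.I_l_closed h_mult h_C)
      have "\<one>\<^bsub>R\<^esub> \<ominus>\<^bsub>R\<^esub> ?g \<in> J"
        using J gR hg by (auto simp: I_def h_diff h_one)
      then have "(\<one>\<^bsub>R\<^esub> \<ominus>\<^bsub>R\<^esub> ?g) \<oplus>\<^bsub>R\<^esub> ?g \<in> J"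
        using g by (rule J.a_closed)
      also have "(\<one>\<^bsub>R\<^esub> \<ominus>\<^bsub>R\<^esub> ?g) \<oplus>\<^bsub>R\<^esub> ?g = \<one>\<^bsub>R\<^esub>"
        using gR by (simp add: minus_eq a_assoc l_neg)
      finally show ?thesis
        using J.one_imp_carrier by blast
    qed simp
  qed
  have "(\<lambda>f. I +>\<^bsub>R\<^esub> f) ` constant_functions M = carrier (R Quot I)"
  proof -
    have coset: "I +>\<^bsub>R\<^esub> f = I +>\<^bsub>R\<^esub> C (h f)" if "f \<in> carrier R" for f
      using quotient_eq_iff_same_a_r_cos[OF ideal that C_carrier] shift[OF that] by blast
    have "carrier (R Quot I) = (\<lambda>f. I +>\<^bsub>R\<^esub> f) ` carrier R"
      unfolding FactRing_def A_RCOSETS_def' by (simp add: UNION_singleton_eq_range)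
    also have "\<dots> = (\<lambda>f. I +>\<^bsub>R\<^esub> f) ` range C"
    proof (intro equalityI subsetI)
      fix S assume "S \<in> (\<lambda>f. I +>\<^bsub>R\<^esub> f) ` carrier R"
      then obtain f where "f \<in> carrier R" "S = I +>\<^bsub>R\<^esub> f" by (rule imageE)
      then have "S = I +>\<^bsub>R\<^esub> C (h f)" by (simp only: coset)
      then show "S \<in> (\<lambda>f. I +>\<^bsub>R\<^esub> f) ` range C" by (simp only: imageI rangeI)
    qed (use C_carrier in blast)
    also have "range C = constant_functions M"
      by (simp add: constant_functions_def C_def)
    finally show ?thesis by (rule sym)
  qed
  with maximal have "real_maximal_ideal M I"
    by (simp add: real_maximal_ideal_def R_def)
  with realcompact have "fixed_ideal M I"
    by (simp add: realcompact_space_def)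
  then obtain x where x: "\<forall>f\<in>I. x \<in> zero_set M f"
    unfolding fixed_ideal_def by blast
  \<comment> \<open>Zero sets lie in \<open>space M\<close>, so any one member of \<open>I\<close>
    suffices to place \<open>x\<close> there.\<close>
  have "\<zero>\<^bsub>R\<^esub> \<in> I"
    by (simp add: I_def h_zero)
  with x have xM: "x \<in> space M"
    by (auto simp: zero_set_def)
  have "h f = f x" if f: "f \<in> carrier R" for f
  proof -
    \<comment> \<open>Subtraction is handled through the ring axioms alone, so \<open>f x\<close> is
      recovered by adding the constant back, addition being pointwise.\<close>
    let ?d = "f \<ominus>\<^bsub>R\<^esub> C (h f)"
    have "?d x = 0"
      using x shift[OF f] by (auto simp: zero_set_def)
    moreover have "?d \<oplus>\<^bsub>R\<^esub> C (h f) = f"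
      using f by (simp add: minus_eq a_assoc l_neg)
    moreover have "(?d \<oplus>\<^bsub>R\<^esub> C (h f)) x = ?d x + h f"
      using xM by (simp add: R_def measurable_ring_simps C_def)
    ultimately show ?thesis by simp
  qed
  with xM show ?thesis by blast
qed

section \<open>From a ring isomorphism to an isomorphism of spaces\<close>

lemma ring_iso_induces_point_map:
  assumes \<phi>: "\<phi> \<in> ring_iso (measurable_ring M) (measurable_ring N)"
    and realcompact: "realcompact_space M"
  obtains s where "s \<in> space N \<rightarrow> space M"
    and "\<And>f y. f \<in> carrier (measurable_ring M) \<Longrightarrow> y \<in> space N \<Longrightarrow> \<phi> f y = f (s y)"
proof -
  have "\<exists>x\<in>space M. \<forall>f\<in>carrier (measurable_ring M). \<phi> f y = f x" if y: "y \<in> space N" for y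
  proof (rule realcompact_character_eq_evaluation[OF realcompact])
    show "\<phi> (f \<oplus>\<^bsub>measurable_ring M\<^esub> g) y = \<phi> f y + \<phi> g y"
      if "f \<in> carrier (measurable_ring M)" "g \<in> carrier (measurable_ring M)" for f g
      using ring_iso_memE(3)[OF \<phi> that] y by (simp add: measurable_ring_simps(5)[of N])
    show "\<phi> (f \<otimes>\<^bsub>measurable_ring M\<^esub> g) y = \<phi> f y * \<phi> g y"
      if "f \<in> carrier (measurable_ring M)" "g \<in> carrier (measurable_ring M)" for f g
      using ring_iso_memE(2)[OF \<phi> that] y by (simp add: measurable_ring_simps(2)[of N])
    show "\<phi> \<one>\<^bsub>measurable_ring M\<^esub> y = 1"
      using ring_iso_memE(4)[OF \<phi>] y by (simp add: measurable_ring_simps(3)[of N])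
  qed
  then obtain s where "\<forall>y\<in>space N. s y \<in> space M \<and> (\<forall>f\<in>carrier (measurable_ring M). \<phi> f y = f (s y))"
    by metis
  then show thesis
    by (intro that[of s]) auto
qed

text \<open>Restricted indicators of measurable sets belong to the ring, so the ring distinguishes
  any two points that a measurable set distinguishes.\<close>

lemma separated_space_eqI:
  assumes "separated_space M" "p \<in> space M" "q \<in> space M"
    and eq: "\<And>f. f \<in> carrier (measurable_ring M) \<Longrightarrow> f p = f q"
  shows "p = q"
proof (rule ccontr)
  assume "p \<noteq> q"
  with assms obtain E where E: "E \<in> sets M" "(p \<in> E) \<noteq> (q \<in> E)"
    unfolding separated_space_def by blast
  then show False
    using eq[OF restrict_in_carrier_measurable_ring[OF borel_measurable_indicator[OF E(1)]]] assms(2,3)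
    by (auto simp: indicator_def split: if_splits)
qed

text \<open>Applying \<phi> to the indicator of \<open>E\<close> gives a measurable function, and
  the preimage of \<open>E\<close> is its level set at 1.\<close>

lemma vimage_point_map_in_sets:
  assumes \<phi>: "\<phi> \<in> ring_iso (measurable_ring M) (measurable_ring N)"
    and s: "\<And>f y. f \<in> carrier (measurable_ring M) \<Longrightarrow> y \<in> space N \<Longrightarrow> \<phi> f y = f (s y)"
    and s_in: "s \<in> space N \<rightarrow> space M"
    and E: "E \<in> sets M"
  shows "s -` E \<inter> space N \<in> sets N"
proof -
  let ?f = "\<lambda>x\<in>space M. indicator E x :: real"
  have f: "?f \<in> carrier (measurable_ring M)"
    using E by (intro restrict_in_carrier_measurable_ring) simp
  then have "\<phi> ?f \<in> borel_measurable N"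
    using ring_iso_memE(1)[OF \<phi>] by (simp add: measurable_ring_simps)
  then have "\<phi> ?f -` {1} \<inter> space N \<in> sets N"
    by (rule measurable_sets) simp
  \<comment> \<open>By \<open>s_in\<close>, the function \<open>?f\<close> is evaluated only inside
    \<open>space M\<close>, where it is the indicator and not \<open>undefined\<close>.\<close>
  also have "\<phi> ?f -` {1} \<inter> space N = s -` E \<inter> space N"
    using s[OF f] s_in by (auto simp: indicator_def Pi_iff split: if_splits)
  finally show ?thesis .
qed

lemma ring_iso_imp_isomorphic_measurable_spaces:
  assumes "separated_space M" "separated_space N"
    and "realcompact_space M" "realcompact_space N"
    and iso: "measurable_ring M \<simeq> measurable_ring N"
  shows "isomorphic_measurable_spaces M N"
proof -
  interpret M: cring "measurable_ring M" by (rule cring_measurable_ring)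
  from iso obtain \<phi> where \<phi>: "\<phi> \<in> ring_iso (measurable_ring M) (measurable_ring N)"
    by (auto simp: is_ring_iso_def)
  define \<psi> where "\<psi> = inv_into (carrier (measurable_ring M)) \<phi>"
  have \<psi>: "\<psi> \<in> ring_iso (measurable_ring N) (measurable_ring M)"
    unfolding \<psi>_def by (rule ring_iso_set_sym[OF M.ring_axioms \<phi>])
  have bij: "bij_betw \<phi> (carrier (measurable_ring M)) (carrier (measurable_ring N))"
    by (rule ring_iso_memE(5)[OF \<phi>])
  obtain s where s_in: "s \<in> space N \<rightarrow> space M"
    and s: "\<And>f y. f \<in> carrier (measurable_ring M) \<Longrightarrow> y \<in> space N \<Longrightarrow> \<phi> f y = f (s y)"
    using ring_iso_induces_point_map[OF \<phi> assms(3)] by blast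
  obtain t where t_in: "t \<in> space M \<rightarrow> space N"
    and t: "\<And>g x. g \<in> carrier (measurable_ring N) \<Longrightarrow> x \<in> space M \<Longrightarrow> \<psi> g x = g (t x)"
    using ring_iso_induces_point_map[OF \<psi> assms(4)] by blast
  have st: "s (t x) = x" if x: "x \<in> space M" for x
  proof (rule separated_space_eqI[OF assms(1)])
    fix f assume f: "f \<in> carrier (measurable_ring M)"
    \<comment> \<open>Evaluating \<open>\<psi> g\<close> at \<open>x\<close> means evaluating
      \<open>g\<close> at \<open>t x\<close>; with \<open>g\<close> equal to
      \<open>\<phi> f\<close>, this moves on to \<open>s (t x)\<close>.\<close>
    have "f (s (t x)) = \<psi> (\<phi> f) x"
      using f x t_in by (simp add: s t ring_iso_memE(1)[OF \<phi>] Pi_iff)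
    also have "\<psi> (\<phi> f) = f"
      using bij f by (simp add: \<psi>_def bij_betw_inv_into_left)
    finally show "f (s (t x)) = f x" .
  qed (use x s_in t_in in auto)
  have ts: "t (s y) = y" if y: "y \<in> space N" for y
  proof (rule separated_space_eqI[OF assms(2)])
    fix g assume g: "g \<in> carrier (measurable_ring N)"
    have "g (t (s y)) = \<phi> (\<psi> g) y"
      using g y s_in by (simp add: s t ring_iso_memE(1)[OF \<psi>] Pi_iff)
    also have "\<phi> (\<psi> g) = g"
      using bij g by (simp add: \<psi>_def bij_betw_inv_into_right)
    finally show "g (t (s y)) = g y" .
  qed (use y s_in t_in in auto)
  have "bij_betw t (space M) (space N)"
    using st ts s_in t_in by (intro bij_betwI[where g = s]) auto
  moreover have "E \<in> sets M \<longleftrightarrow> t ` E \<in> sets N" if E: "E \<subseteq> space M" for E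
  proof
    \<comment> \<open>Both directions become statements about preimages: under \<open>s\<close> for
      the forward one, under \<open>t\<close> for the converse.\<close>
    have eq: "s -` E \<inter> space N = t ` E"
      using E st ts t_in by (force simp: image_iff)
    show "t ` E \<in> sets N" if "E \<in> sets M"
      using vimage_point_map_in_sets[OF \<phi> s s_in that] by (simp add: eq)
    have eq': "t -` (t ` E) \<inter> space M = E"
    proof (intro equalityI subsetI)
      fix x assume "x \<in> t -` (t ` E) \<inter> space M"
      then obtain z where "z \<in> E" "t x = t z" "x \<in> space M" by auto
      then show "x \<in> E"
        using st[of x] st[of z] E by auto
    qed (use E in auto)
    show "E \<in> sets M" if "t ` E \<in> sets N"
      using vimage_point_map_in_sets[OF \<psi> t t_in that] by (simp add: eq')
  qed
  ultimately show ?thesis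
    by (auto simp: isomorphic_measurable_spaces_def measurable_space_iso_def)
qed

section \<open>From an isomorphism of spaces to a ring isomorphism\<close>

lemma isomorphic_measurable_spaces_imp_ring_iso:
  assumes "isomorphic_measurable_spaces M N"
  shows "measurable_ring M \<simeq> measurable_ring N"
proof -
  obtain t where bij: "bij_betw t (space M) (space N)"
    and sets: "\<And>E. E \<subseteq> space M \<Longrightarrow> E \<in> sets M \<longleftrightarrow> t ` E \<in> sets N"
    using assms by (auto simp: isomorphic_measurable_spaces_def measurable_space_iso_def)
  define s where "s = inv_into (space M) t"
  have t_in: "t x \<in> space N" and st: "s (t x) = x" if "x \<in> space M" for x
    using bij that by (auto simp: s_def bij_betw_inv_into_left bij_betwE)
  have s_in: "s y \<in> space M" and ts: "t (s y) = y" if "y \<in> space N" for y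
    using bij that bij_betwE[OF bij_betw_inv_into[OF bij]]
    by (auto simp: s_def bij_betw_inv_into_right)
  have s_meas: "s \<in> measurable N M"
  proof (rule measurableI)
    fix E assume E: "E \<in> sets M"
    have "E \<subseteq> space M" using E by (rule sets.sets_into_space)
    moreover have "s -` E \<inter> space N = t ` E"
      using calculation st ts t_in by (force simp: image_iff)
    ultimately show "s -` E \<inter> space N \<in> sets N"
      using sets E by simp
  qed (rule s_in)
  have t_meas: "t \<in> measurable M N"
  proof (rule measurableI)
    fix E assume E: "E \<in> sets N"
    \<comment> \<open>The hypothesis concerns images under \<open>t\<close>, so it is applied to the
      preimage of \<open>E\<close>, whose image is all of \<open>E\<close> by surjectivity.\<close>
    have "t ` (t -` E \<inter> space M) = E"
    proof (intro equalityI subsetI)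
      fix y assume "y \<in> E"
      moreover then have "y \<in> space N"
        using sets.sets_into_space[OF E] by blast
      ultimately show "y \<in> t ` (t -` E \<inter> space M)"
        using ts[of y] s_in[of y] by (intro image_eqI[of _ _ "s y"]) auto
    qed auto
    then show "t -` E \<inter> space M \<in> sets M"
      using sets[of "t -` E \<inter> space M"] E by simp
  qed (rule t_in)
  \<comment> \<open>Functions are transported by composition with the inverse point map. Restriction
    resets the value outside the space to \<open>undefined\<close>, as membership in the carrier
    requires.\<close>
  define \<phi> where "\<phi> f = (\<lambda>y\<in>space N. f (s y))" for f :: "'a \<Rightarrow> real"
  define \<psi> where "\<psi> g = (\<lambda>x\<in>space M. g (t x))" for g :: "'b \<Rightarrow> real"
  have \<phi>_in: "\<phi> f \<in> carrier (measurable_ring N)" if "f \<in> carrier (measurable_ring M)" for f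
    unfolding \<phi>_def using that s_meas
    by (intro restrict_in_carrier_measurable_ring) (auto simp: measurable_ring_simps)
  have \<psi>_in: "\<psi> g \<in> carrier (measurable_ring M)" if "g \<in> carrier (measurable_ring N)" for g
    unfolding \<psi>_def using that t_meas
    by (intro restrict_in_carrier_measurable_ring) (auto simp: measurable_ring_simps)
  have "\<phi> \<in> ring_iso (measurable_ring M) (measurable_ring N)"
  proof (rule ring_iso_memI)
    show "bij_betw \<phi> (carrier (measurable_ring M)) (carrier (measurable_ring N))"
    proof (rule bij_betwI[where g = \<psi>])
      show "\<psi> (\<phi> f) = f" if "f \<in> carrier (measurable_ring M)" for f
        using that by (intro extensionalityI[of _ "space M"])
          (auto simp: \<phi>_def \<psi>_def measurable_ring_simps t_in st)
      show "\<phi> (\<psi> g) = g" if "g \<in> carrier (measurable_ring N)" for g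
        using that by (intro extensionalityI[of _ "space N"])
          (auto simp: \<phi>_def \<psi>_def measurable_ring_simps s_in ts)
    qed (use \<phi>_in \<psi>_in in auto)
  \<comment> \<open>The operations are pointwise, hence preserved by composition with
    \<open>s\<close>; since \<open>s y\<close> lies in \<open>space M\<close>, the restriction built
    into them has no effect there.\<close>
  qed (auto simp: \<phi>_in, auto simp: \<phi>_def measurable_ring_simps s_in)
  then show ?thesis
    by (auto simp: is_ring_iso_def)
qed

theorem theorem2p9:
  fixes M :: "'a measure" and N :: "'b measure"
  assumes "space M \<noteq> {}" and "space N \<noteq> {}"
    and "separated_space M" and "separated_space N"
    and "realcompact_space M" and "realcompact_space N"
  shows "isomorphic_measurable_spaces M N \<longleftrightarrow> measurable_ring M \<simeq> measurable_ring N"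
  using isomorphic_measurable_spaces_imp_ring_iso
    ring_iso_imp_isomorphic_measurable_spaces[OF assms(3-6)]
  by blast

end
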